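(* Let $(M,Q)$ be a random vector with $\mathbb{P}(M\in[0,1))=1$, $\mathbb{P}(Q\ge0)=1$ and $\mathbb{E}e^{zQ}<\infty$ for all $z\in\mathbb{R}$, and let $R$ be the perpetuity generated by $(M,Q)$. Define $$h(x):=\inf_{t\ge1}\left\{-t\log\mathbb{P}\left(\frac1{1-M}>t,\;Q>\frac xt\right)\right\},$$ and assume that $h\in\mathcal{R}_\gamma$ with $\gamma\in[1,\infty]$; if $\gamma=\infty$, assume additionally that $h\in\Gamma\subset\mathcal{R}_\infty$. Assume moreover that there is a function $t$ with values in $[1,\infty)$ such that $$h(x)=-t(x)\log\mathbb{P}\left(\frac{1}{1-M}>t(x),\;Q>\frac{x}{t(x)}\right)+o(1)\qquad(x\to\infty)$$ and $\lim_{x\to\infty}t(x)=t_\infty\in(1,\infty]$. Then $$\liminf_{x\to\infty}\frac{\log\mathbb{P}(R>x)}{h(x)}\ge-c_{t_\infty,\gamma},$$ where the finite positive constants $c_{t,\gamma}$ are given, for $t\in(1,\infty)$ and $\gamma\in(1,\infty)$, by $$c_{t,1}=c_{\infty,1}=1,\qquad c_{t,\gamma}=\left[t\left\{1-\left(1-\frac1t\right)^{\gamma/(\gamma-1)}\right\}\right]^{\gamma-1},\qquad c_{\infty,\gamma}=\left(\frac{\gamma}{\gamma-1}\right)^{\gamma-1},$$ $$c_{\infty,\infty}=e,\qquad c_{t,\infty}=\left(1+\frac1t\right)^{1+t}.$$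
   Context: Notation. $-\log 0:=+\infty$. Regular variation: for $\rho\in\mathbb{R}$, $\mathcal{R}_\rho$ is the class of positive measurable functions $g$ defined in a neighbourhood of $+\infty$ with $\lim_{x\to\infty}g(tx)/g(x)=t^\rho$ for all $t>0$; $\mathcal{R}_\infty$ is the class of measurable functions $g$ with $\lim_{x\to\infty}g(tx)/g(x)=\infty$ for all $t>1$. The class $\Gamma$ consists of nondecreasing right-continuous functions $f$ for which there exists a measurable function $g:\mathbb{R}\to(0,\infty)$ such that $\lim_{x\to\infty}f(x+ug(x))/f(x)=e^u$ for all $u\in\mathbb{R}$. Perpetuity: the perpetuity $R$ generated by $(M,Q)$ is the (unique in law) random variable satisfying $R\stackrel{d}{=}MR+Q$ with $R$ and $(M,Q)$ independent on the right-hand side; equivalently $R\stackrel{d}{=}\sum_{j=1}^\infty Q_j\prod_{k=1}^{j-1}M_k$, where $(M_n,Q_n)_{n\ge1}$ are i.i.d. copies of $(M,Q)$. *)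

theory Defs
  imports "HOL-Probability.Probability"
begin

(* The conventions -log 0 = +\<infinity> and log 0 = -\<infinity>; HOL has ln 0 = 0. *)

definition neg_log :: "real \<Rightarrow> ereal" where
  "neg_log p = (if p = 0 then \<infinity> else ereal (- ln p))"

definition ext_log :: "real \<Rightarrow> ereal" where
  "ext_log p = - neg_log p"

definition measurable_near_infinity :: "(real \<Rightarrow> real) \<Rightarrow> bool" where
  "measurable_near_infinity g \<longleftrightarrow> (\<exists>a. g \<in> borel_measurable (restrict_space borel {a..}))"

definition regularly_varying :: "real \<Rightarrow> (real \<Rightarrow> real) set" where
  "regularly_varying \<rho> = {g. measurable_near_infinity g \<and> (\<forall>\<^sub>F x in at_top. g x > 0) \<and>
     (\<forall>t>0. ((\<lambda>x. g (t * x) / g x) \<longlongrightarrow> t powr \<rho>) at_top)}"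

definition rapidly_varying :: "(real \<Rightarrow> real) set" where
  "rapidly_varying = {g. measurable_near_infinity g \<and>
     (\<forall>t>1. filterlim (\<lambda>x. g (t * x) / g x) at_top at_top)}"

definition class_Gamma :: "(real \<Rightarrow> real) set" where
  "class_Gamma = {f. mono f \<and> (\<forall>x. continuous (at_right x) f) \<and>
     (\<exists>g \<in> borel_measurable borel. (\<forall>x. g x > 0) \<and>
        (\<forall>u. ((\<lambda>x. f (x + u * g x) / f x) \<longlongrightarrow> exp u) at_top))}"

(* R need not live on the space of (M, Q): the product measure expresses that the copy of R
   on the right-hand side of R = M R + Q (in law) is independent of (M, Q). *)

definition is_perpetuity ::
  "'a measure \<Rightarrow> ('a \<Rightarrow> real) \<Rightarrow> ('a \<Rightarrow> real) \<Rightarrow> 'b measure \<Rightarrow> ('b \<Rightarrow> real) \<Rightarrow> bool" where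
  "is_perpetuity P M Q N R \<longleftrightarrow>
     prob_space N \<and> R \<in> borel_measurable N \<and>
     distr N borel R = distr (P \<Otimes>\<^sub>M N) borel (\<lambda>(\<omega>, \<omega>'). M \<omega> * R \<omega>' + Q \<omega>)"

definition perp_cost ::
  "'a measure \<Rightarrow> ('a \<Rightarrow> real) \<Rightarrow> ('a \<Rightarrow> real) \<Rightarrow> real \<Rightarrow> real \<Rightarrow> ereal" where
  "perp_cost P M Q t x = ereal t * neg_log (\<P>(\<omega> in P. 1 / (1 - M \<omega>) > t \<and> Q \<omega> > x / t))"

definition perp_rate ::
  "'a measure \<Rightarrow> ('a \<Rightarrow> real) \<Rightarrow> ('a \<Rightarrow> real) \<Rightarrow> real \<Rightarrow> ereal" where
  "perp_rate P M Q x = (INF t\<in>{1..}. perp_cost P M Q t x)"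

(* Only meaningful for 1 < t \<le> \<infinity> and 1 \<le> \<gamma> \<le> \<infinity>. *)

definition perp_const :: "ereal \<Rightarrow> ereal \<Rightarrow> real" where
  "perp_const t \<gamma> =
    (let s = real_of_ereal t; g = real_of_ereal \<gamma> in
     if \<gamma> = 1 then 1
     else if \<gamma> = \<infinity> then (if t = \<infinity> then exp 1 else (1 + 1 / s) powr (1 + s))
     else if t = \<infinity> then (g / (g - 1)) powr (g - 1)
     else (s * (1 - (1 - 1 / s) powr (g / (g - 1)))) powr (g - 1))"

lemma perp_const_pos:
  assumes "1 < t" "1 \<le> \<gamma>"
  shows "0 < perp_const t \<gamma>"
proof -
  have *: "0 < s * (1 - (1 - 1 / s) powr (g / (g - 1)))" if "1 < s" "1 < g" for s g :: real
  proof -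
    have "(1 - 1 / s) powr (g / (g - 1)) < 1 powr (g / (g - 1))"
      using that by (intro powr_less_mono2) (auto simp: field_simps)
    then show ?thesis using that by simp
  qed
  have **: "1 + 1 / s \<noteq> 0" if "1 < s" for s :: real
    using that by (simp add: field_simps)
  show ?thesis
    using assms
    by (cases t; cases \<gamma>) (auto simp: perp_const_def Let_def one_ereal_def **
          less_imp_neq[OF *, symmetric] dest!: order_le_imp_less_or_eq)
qed

end

theory Submission
  imports Defs "HOL-Real_Asymp.Real_Asymp"
begin

text \<open>
  Let \<open>F x\<close> be the probability of \<open>R > x\<close>. If the current value of the perpetuity exceeds \<open>x \<ge> 0\<close>
  and the next pair satisfies \<open>1 / (1 - M) > t\<close> and \<open>Q > u / t\<close>, then the new value exceeds
  \<open>(1 - 1 / t) * x + u / t\<close>: it has covered at least the fraction \<open>1 / t\<close> of the way from \<open>x\<close> to \<open>u\<close>.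
  For \<open>t = \<tau> u\<close> the logarithmic price of this step is \<open>(h u + o(1)) / \<tau> u\<close>. Thus \<open>n\<close> steps aimed at the
  same \<open>u\<close> shrink the distance to \<open>u\<close> by the factor \<open>(1 - 1 / \<tau> u) ^ n\<close> and cost about
  \<open>n / \<tau> u * h u\<close>. Shrinking by a given factor \<open>w > 1\<close> therefore costs at most \<open>\<kappa> * h u\<close> for every \<open>\<kappa>\<close> above
  \<open>ln w\<close> if \<open>\<tau>\<close> tends to infinity (many small steps, \<open>affordable_infinite\<close>), while if \<open>\<tau>\<close> tends to
  \<open>t < \<infinity>\<close>, a single step suffices for \<open>w < t / (t - 1)\<close>, at any \<open>\<kappa> > 1 / t\<close> (\<open>affordable_finite\<close>).

  To reach a high level \<open>x\<close>, start such a block of steps at a lower level \<open>x'\<close> and aim at a level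
  \<open>u > x\<close>. This gives \<open>- ln (F x) \<le> - ln (F x') + \<kappa> * h u\<close> (\<open>macro_step\<close>). Choose \<open>x'\<close> and \<open>u\<close> so
  that \<open>h x' / h x \<rightarrow> A < 1\<close> and \<open>h u / h x \<rightarrow> B\<close>: for regularly varying \<open>h\<close> of index \<open>\<gamma>\<close> take
  \<open>x' = a * x\<close> and \<open>u = b * x\<close>, which gives \<open>A = a powr \<gamma>\<close> and \<open>B = b powr \<gamma>\<close>; for \<open>h\<close> in the class
  \<open>\<Gamma>\<close> with auxiliary function \<open>g\<close> take \<open>x' = x - \<alpha> * g x\<close> and \<open>u = x + \<beta> * g x\<close>, which gives
  \<open>A = exp (- \<alpha>)\<close> and \<open>B = exp \<beta>\<close>. Iterating down to a fixed level sums a geometric series, so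
  \<open>- ln (F x) \<le> C * h x\<close> eventually, for every \<open>C > \<kappa> * B / (1 - A)\<close> (\<open>bound_by_descent\<close>). It remains
  to choose the two parameters such that \<open>\<kappa> * B / (1 - A)\<close> comes arbitrarily close to the required
  constant.
\<close>

section \<open>Covering a fixed proportion of the distance to a target\<close>

text \<open>
  The number \<open>n / \<tau> u\<close> is the price, in units of \<open>h u\<close>, of \<open>n\<close> steps aimed at \<open>u\<close>; these divide the distance
  to \<open>u\<close> by at least \<open>w\<close>.
\<close>
definition affordable :: "(real \<Rightarrow> real) \<Rightarrow> real \<Rightarrow> real \<Rightarrow> bool" where
  "affordable \<tau> w \<kappa> \<longleftrightarrow>
     (\<forall>\<^sub>F u in at_top. \<exists>n::nat. w * (1 - 1 / \<tau> u) ^ n \<le> 1 \<and> real n / \<tau> u \<le> \<kappa>)"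

lemma affordable_finite:
  fixes t :: real
  assumes "(\<tau> \<longlongrightarrow> t) at_top" "1 < t" "w * (1 - 1 / t) < 1" "1 / t < \<kappa>"
  shows "affordable \<tau> w \<kappa>"
proof -
  have "((\<lambda>u. w * (1 - 1 / \<tau> u)) \<longlongrightarrow> w * (1 - 1 / t)) at_top"
    using assms by (intro tendsto_intros) auto
  moreover have "((\<lambda>u. 1 / \<tau> u) \<longlongrightarrow> 1 / t) at_top"
    using assms by (intro tendsto_intros) auto
  ultimately have "\<forall>\<^sub>F u in at_top. w * (1 - 1 / \<tau> u) < 1 \<and> 1 / \<tau> u < \<kappa>"
    using assms by (intro eventually_conj order_tendstoD(2)) auto
  then show ?thesis
    unfolding affordable_def
    by eventually_elim (intro exI[of _ 1], auto)
qed

text \<open>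
  About \<open>\<tau> u * ln w\<close> steps suffice, because \<open>1 - 1 / \<tau> u \<le> exp (- 1 / \<tau> u)\<close>; rounding this number
  up changes the price by at most \<open>1 / \<tau> u\<close>, which vanishes in the limit.
\<close>
lemma affordable_infinite:
  assumes "filterlim \<tau> at_top at_top" "1 \<le> w" "ln w < \<kappa>"
  shows "affordable \<tau> w \<kappa>"
proof -
  have "((\<lambda>u. 1 / \<tau> u) \<longlongrightarrow> 0) at_top"
    by (rule tendsto_divide_0[OF tendsto_const filterlim_at_top_imp_at_infinity]) fact
  then have "\<forall>\<^sub>F u in at_top. 1 / \<tau> u < \<kappa> - ln w"
    using assms by (intro order_tendstoD(2)) auto
  moreover have "\<forall>\<^sub>F u in at_top. 1 \<le> \<tau> u"
    using assms(1) by (simp add: filterlim_at_top)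
  ultimately show ?thesis
    unfolding affordable_def
  proof eventually_elim
    case (elim u)
    define n where "n = nat \<lceil>\<tau> u * ln w\<rceil>"
    have "0 \<le> \<tau> u * ln w" using assms elim by simp
    then have n: "\<tau> u * ln w \<le> n" "n \<le> \<tau> u * ln w + 1"
      unfolding n_def by linarith+
    have "(1 - 1 / \<tau> u) ^ n \<le> exp (- (1 / \<tau> u)) ^ n"
      using elim exp_ge_add_one_self[of "- (1 / \<tau> u)"] by (intro power_mono) auto
    also have "\<dots> = exp (- (n / \<tau> u))"
      by (simp flip: exp_of_nat_mult)
    also have "\<dots> \<le> exp (- ln w)"
      using n elim by (simp add: field_simps)
    also have "\<dots> = 1 / w"
      using assms by (simp add: exp_minus field_simps)
    finally have "w * (1 - 1 / \<tau> u) ^ n \<le> 1"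
      using assms by (simp add: field_simps)
    moreover have "n / \<tau> u \<le> ln w + 1 / \<tau> u"
      using n elim by (simp add: field_simps)
    ultimately show ?case
      using elim by (intro exI[of _ n]) auto
  qed
qed

section \<open>Iterating a descent inequality\<close>

text \<open>
  One descent from \<open>x\<close> to \<open>x' x\<close> costs about \<open>\<kappa> * B * f x\<close> and multiplies \<open>f\<close> by about \<open>A\<close>, so
  the total cost is at most about \<open>\<kappa> * B * (1 + A + A\<^sup>2 + \<dots>) * f x\<close>. The descent is measured by the
  values of \<open>f\<close> rather than by the levels themselves: these values shrink geometrically, so that
  a fixed threshold is passed after finitely many descents.
\<close>
lemma bound_by_descent:
  fixes H f :: "real \<Rightarrow> real"
  assumes "mono H" "mono f" "filterlim f at_top at_top"
    and descent: "\<forall>\<^sub>F x in at_top. H x \<le> H (x' x) + \<kappa> * f (u x)"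
    and A: "((\<lambda>x. f (x' x) / f x) \<longlongrightarrow> A) at_top" "0 < A" "A < 1"
    and B: "((\<lambda>x. f (u x) / f x) \<longlongrightarrow> B) at_top" "0 < B"
    and "0 \<le> \<kappa>" and C: "\<kappa> * B / (1 - A) < C"
  shows "\<forall>\<^sub>F x in at_top. H x \<le> C * f x"
proof -
  have "0 \<le> \<kappa> * B / (1 - A)" using assms by simp
  obtain C' where C': "\<kappa> * B / (1 - A) < C'" "C' < C"
    using dense[OF C] by auto
  with \<open>0 \<le> \<kappa> * B / (1 - A)\<close> have "0 < C'" by linarith
  have "((\<lambda>r. C' * (1 - r)) \<longlongrightarrow> C' * (1 - A)) (at_right A)"
    by (intro tendsto_intros)
  then have "\<forall>\<^sub>F r in at_right A. \<kappa> * B < C' * (1 - r)"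
    using C' A by (intro order_tendstoD(1)) (auto simp: field_simps)
  moreover have "\<forall>\<^sub>F r in at_right A. r \<in> {A<..<1}"
    using A by (intro eventually_at_right_real) auto
  ultimately have "\<forall>\<^sub>F r in at_right A. \<kappa> * B < C' * (1 - r) \<and> r \<in> {A<..<1}"
    by (rule eventually_conj)
  from eventually_happens[OF this] obtain r where r: "\<kappa> * B < C' * (1 - r)" "A < r" "r < 1"
    by auto
  have "((\<lambda>x. \<kappa> * (f (u x) / f x)) \<longlongrightarrow> \<kappa> * B) at_top"
    by (intro tendsto_intros B)
  then have "\<forall>\<^sub>F x in at_top. \<kappa> * (f (u x) / f x) < C' * (1 - r)"
    using r by (intro order_tendstoD(2)) auto
  moreover have "\<forall>\<^sub>F x in at_top. f (x' x) / f x < r"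
    using A r by (intro order_tendstoD(2)) auto
  moreover have "\<forall>\<^sub>F x in at_top. 1 \<le> f x"
    using assms(3) by (simp add: filterlim_at_top)
  ultimately have "\<forall>\<^sub>F x in at_top. H x \<le> H (x' x) + \<kappa> * f (u x)
      \<and> \<kappa> * f (u x) \<le> C' * (1 - r) * f x \<and> f (x' x) \<le> r * f x \<and> 1 \<le> f x"
    using descent by eventually_elim (auto simp: field_simps)
  then obtain X where X: "\<And>x. x \<ge> X \<Longrightarrow> H x \<le> H (x' x) + \<kappa> * f (u x)"
      "\<And>x. x \<ge> X \<Longrightarrow> \<kappa> * f (u x) \<le> C' * (1 - r) * f x"
      "\<And>x. x \<ge> X \<Longrightarrow> f (x' x) \<le> r * f x" "\<And>x. x \<ge> X \<Longrightarrow> 1 \<le> f x"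
    unfolding eventually_at_top_linorder by auto
  have r0: "0 < r" using A r by simp
  \<comment> \<open>The number \<open>n\<close> bounds how many descents from \<open>x\<close> stay above the threshold \<open>X\<close>; for \<open>n = 0\<close>
    there is no such \<open>x\<close>, because \<open>f\<close> is monotone.\<close>
  have levels: "H x \<le> C' * f x + H X" if "x \<ge> X" "r ^ n * f x < f X" for n x
    using that
  proof (induction n arbitrary: x)
    case 0
    then show ?case using monoD[OF \<open>mono f\<close>, of X x] by auto
  next
    case (Suc n)
    have fx: "1 \<le> f x" using X Suc.prems by simp
    have "H (x' x) \<le> C' * (r * f x) + H X"
    proof (cases "x' x \<ge> X")
      case True
      have "r ^ n * f (x' x) \<le> r ^ n * (r * f x)"
        using X(3)[OF Suc.prems(1)] r0 by (intro mult_left_mono) auto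
      also have "\<dots> < f X" using Suc.prems by (simp add: algebra_simps)
      finally have "H (x' x) \<le> C' * f (x' x) + H X"
        using Suc.IH True by blast
      also have "\<dots> \<le> C' * (r * f x) + H X"
        using X(3)[OF Suc.prems(1)] \<open>0 < C'\<close> by simp
      finally show ?thesis .
    next
      case False
      then have "H (x' x) \<le> H X" using \<open>mono H\<close> by (auto simp: mono_def)
      moreover have "0 \<le> C' * (r * f x)" using \<open>0 < C'\<close> r0 fx by simp
      ultimately show ?thesis by linarith
    qed
    then show ?case
      using X(1,2)[OF Suc.prems(1)] by (simp add: algebra_simps)
  qed
  have all: "H x \<le> C' * f x + H X" if "x \<ge> X" for x
  proof -
    have "(\<lambda>n. r ^ n * f x) \<longlonglongrightarrow> 0 * f x"
      using r r0 by (intro tendsto_intros LIMSEQ_realpow_zero) auto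
    then have "\<forall>\<^sub>F n in sequentially. r ^ n * f x < f X"
      using X(4)[of X] by (intro order_tendstoD(2)) auto
    from eventually_happens[OF this] show ?thesis
      using levels[OF that] by auto
  qed
  \<comment> \<open>The additive constant is absorbed by the gap between \<open>C'\<close> and \<open>C\<close>.\<close>
  have "\<forall>\<^sub>F x in at_top. H X / (C - C') \<le> f x"
    using assms(3) by (simp add: filterlim_at_top)
  moreover have "\<forall>\<^sub>F x in at_top. x \<ge> X" by (rule eventually_ge_at_top)
  ultimately show ?thesis
  proof eventually_elim
    case (elim x)
    then show ?case using all[of x] C' by (simp add: field_simps)
  qed
qed

section \<open>Lower bounds for the tail from repeated steps\<close>

text \<open>
  The probabilistic input in analytic form: \<open>F\<close> is the tail of the perpetuity, \<open>f\<close> the rate function \<open>h\<close>,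
  and \<open>\<pi> u\<close> the probability of \<open>1 / (1 - M) > \<tau> u\<close> and \<open>Q > u / \<tau> u\<close>. The rule \<open>step\<close> has
  two conditions on \<open>v\<close> because the lower bound for \<open>M * x\<close> with \<open>1 - 1 / \<tau> u < M < 1\<close> depends on
  the sign of \<open>x\<close>.
\<close>
locale perpetuity_tail =
  fixes F \<pi> \<tau> f :: "real \<Rightarrow> real"
  assumes F_anti: "antimono F"
    and F_pos_somewhere: "\<exists>x. 0 < F x"
    and \<tau>_ge_1: "1 \<le> \<tau> u"
    and step: "v \<le> x + u / \<tau> u \<Longrightarrow> v \<le> (1 - 1 / \<tau> u) * x + u / \<tau> u \<Longrightarrow> F x * \<pi> u \<le> F v"
    and cost: "\<forall>\<^sub>F u in at_top. 0 < \<pi> u \<and> - \<tau> u * ln (\<pi> u) \<le> f u + 1"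
    and f_mono: "mono f"
    and f_top: "filterlim f at_top at_top"
begin

text \<open>
  Aim at a fixed target \<open>u\<close> that is at least twice a level \<open>X \<ge> x\<close>. From any value up to \<open>X\<close>, negative
  or not, each step gains at least \<open>X / \<tau> u\<close>, so finitely many steps of positive probability lead
  from a level where \<open>F\<close> is positive to \<open>X\<close>.
\<close>
lemma F_pos: "0 < F x"
proof -
  define X where "X = max x 1"
  have "\<forall>\<^sub>F u in at_top. 2 * X \<le> u" by (rule eventually_ge_at_top)
  with cost have "\<forall>\<^sub>F u in at_top. 2 * X \<le> u \<and> 0 < \<pi> u" by eventually_elim auto
  from eventually_happens[OF this] obtain u where u: "2 * X \<le> u" "0 < \<pi> u" by auto
  have X: "1 \<le> X" "x \<le> X" by (auto simp: X_def)
  have t: "1 \<le> \<tau> u" by (rule \<tau>_ge_1)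
  obtain y where y: "0 < F y" using F_pos_somewhere by blast
  have *: "0 < F (min X (y + n * (X / \<tau> u)))" for n :: nat
  proof (induction n)
    case 0
    have "F y \<le> F (min X y)" using F_anti by (simp add: antimono_def)
    with y show ?case by simp
  next
    case (Suc n)
    define z where "z = min X (y + n * (X / \<tau> u))"
    have "X / \<tau> u \<le> u / \<tau> u" using u t X by (intro divide_right_mono) auto
    then have 1: "z + X / \<tau> u \<le> z + u / \<tau> u" by simp
    have "X / \<tau> u \<le> (u - z) / \<tau> u" using u t X by (intro divide_right_mono) (auto simp: z_def)
    then have 2: "z + X / \<tau> u \<le> (1 - 1 / \<tau> u) * z + u / \<tau> u" by (simp add: diff_divide_distrib algebra_simps)
    have "0 < F z * \<pi> u" using Suc u by (simp add: z_def)
    also have "\<dots> \<le> F (z + X / \<tau> u)" by (rule step[OF 1 2])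
    also have "\<dots> \<le> F (min X (y + Suc n * (X / \<tau> u)))"
    proof -
      have "real (Suc n) * (X / \<tau> u) = n * (X / \<tau> u) + X / \<tau> u"
        by (simp only: of_nat_Suc distrib_right mult_1_left add.commute)
      moreover have "0 \<le> X / \<tau> u" using X t by simp
      ultimately have "min X (y + Suc n * (X / \<tau> u)) \<le> z + X / \<tau> u"
        unfolding z_def min_def by (split if_split)+ linarith
      then show ?thesis using F_anti by (simp add: antimono_def)
    qed
    finally show ?case .
  qed
  obtain n :: nat where n: "(X - y) / (X / \<tau> u) \<le> n" using real_arch_simple by blast
  then have "X - y \<le> n * (X / \<tau> u)" using X t by (simp add: field_simps)
  then have "min X (y + n * (X / \<tau> u)) = X" by simp
  with * have "0 < F X" by metis
  also have "F X \<le> F x" using F_anti X by (simp add: antimono_def)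
  finally show ?thesis .
qed

lemma repeated_step:
  assumes "0 \<le> x" "x \<le> u" "0 \<le> \<pi> u"
  shows "F x * \<pi> u ^ n \<le> F (u - (u - x) * (1 - 1 / \<tau> u) ^ n)"
proof (induction n)
  case (Suc n)
  define z where "z = u - (u - x) * (1 - 1 / \<tau> u) ^ n"
  have t: "1 \<le> \<tau> u" by (rule \<tau>_ge_1)
  have "(1 - 1 / \<tau> u) ^ n \<le> 1" using t by (intro power_le_one) auto
  then have "(u - x) * (1 - 1 / \<tau> u) ^ n \<le> u - x"
    using assms mult_left_mono[of _ 1 "u - x"] by simp
  then have "0 \<le> z" using assms by (simp add: z_def)
  have eq: "u - (u - x) * (1 - 1 / \<tau> u) ^ Suc n = (1 - 1 / \<tau> u) * z + u / \<tau> u"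
    by (simp add: z_def algebra_simps diff_divide_distrib)
  have "F x * \<pi> u ^ Suc n \<le> F z * \<pi> u"
    using mult_right_mono[OF Suc assms(3)] by (simp add: z_def algebra_simps)
  also have "\<dots> \<le> F ((1 - 1 / \<tau> u) * z + u / \<tau> u)"
    using \<open>0 \<le> z\<close> t by (intro step) (auto simp: algebra_simps)
  finally show ?case by (simp only: eq)
qed simp

text \<open>
  The levels satisfy \<open>u - x' \<le> w * (u - x)\<close>, so dividing the distance to \<open>u\<close> by \<open>w\<close>
  leads from \<open>x'\<close> to at least \<open>x\<close>. The gap between \<open>\<kappa>\<close> and \<open>\<kappa>'\<close> pays for the additive
  error in \<open>cost\<close>, since \<open>f\<close> tends to infinity.
\<close>
lemma macro_step:
  assumes "affordable \<tau> w \<kappa>" "\<kappa> < \<kappa>'"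
    and u_top: "filterlim u at_top at_top"
    and x': "\<forall>\<^sub>F x in at_top. 0 \<le> x' x \<and> x' x \<le> u x \<and> x \<le> u x \<and> u x - x' x \<le> w * (u x - x)"
  shows "\<forall>\<^sub>F x in at_top. - ln (F x) \<le> - ln (F (x' x)) + \<kappa>' * f (u x)"
proof -
  have "\<forall>\<^sub>F v in at_top. \<kappa> / (\<kappa>' - \<kappa>) \<le> f v"
    using f_top by (simp add: filterlim_at_top)
  moreover have "\<forall>\<^sub>F v in at_top. 0 \<le> f v"
    using f_top by (simp add: filterlim_at_top)
  ultimately have "\<forall>\<^sub>F v in at_top. 0 < \<pi> v \<and> - \<tau> v * ln (\<pi> v) \<le> f v + 1
      \<and> \<kappa> / (\<kappa>' - \<kappa>) \<le> f v \<and> 0 \<le> f v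
      \<and> (\<exists>n::nat. w * (1 - 1 / \<tau> v) ^ n \<le> 1 \<and> real n / \<tau> v \<le> \<kappa>)"
    using cost assms(1) unfolding affordable_def by eventually_elim auto
  with u_top have "\<forall>\<^sub>F x in at_top. 0 < \<pi> (u x) \<and> - \<tau> (u x) * ln (\<pi> (u x)) \<le> f (u x) + 1
      \<and> \<kappa> / (\<kappa>' - \<kappa>) \<le> f (u x) \<and> 0 \<le> f (u x)
      \<and> (\<exists>n::nat. w * (1 - 1 / \<tau> (u x)) ^ n \<le> 1 \<and> real n / \<tau> (u x) \<le> \<kappa>)"
    unfolding filterlim_iff by blast
  then show ?thesis using x'
  proof eventually_elim
    case (elim x)
    define t p v where "t = \<tau> (u x)" and "p = \<pi> (u x)" and "v = u x"
    obtain n :: nat where n: "w * (1 - 1 / t) ^ n \<le> 1" "n / t \<le> \<kappa>"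
      using elim by (auto simp: t_def)
    have p: "0 < p" "- t * ln p \<le> f v + 1" "\<kappa> / (\<kappa>' - \<kappa>) \<le> f v" "0 \<le> f v"
      using elim by (auto simp: t_def p_def v_def)
    have t: "1 \<le> t" by (simp add: t_def \<tau>_ge_1)
    have "(v - x' x) * (1 - 1 / t) ^ n \<le> (w * (v - x)) * (1 - 1 / t) ^ n"
      using elim t by (intro mult_right_mono) (auto simp: v_def)
    also have "\<dots> = (v - x) * (w * (1 - 1 / t) ^ n)" by simp
    also have "\<dots> \<le> (v - x) * 1"
      using n elim by (intro mult_left_mono) (auto simp: v_def)
    finally have "x \<le> v - (v - x' x) * (1 - 1 / t) ^ n" by simp
    then have "F (v - (v - x' x) * (1 - 1 / t) ^ n) \<le> F x"
      using F_anti by (simp add: antimono_def)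
    moreover have "F (x' x) * p ^ n \<le> F (v - (v - x' x) * (1 - 1 / t) ^ n)"
      unfolding t_def p_def v_def using elim by (intro repeated_step) auto
    ultimately have "ln (F (x' x) * p ^ n) \<le> ln (F x)"
      using F_pos p by (subst ln_le_cancel_iff) auto
    then have "- ln (F x) \<le> - ln (F (x' x)) + n / t * (- t * ln p)"
      using F_pos[of "x' x"] p t by (simp add: ln_mult ln_realpow)
    also have "n / t * (- t * ln p) \<le> n / t * (f v + 1)"
      using t p by (intro mult_left_mono) auto
    also have "\<dots> \<le> \<kappa> * (f v + 1)"
      using n p by (intro mult_right_mono) auto
    also have "\<dots> \<le> \<kappa>' * f v"
      using p assms(2) by (simp add: field_simps)
    finally show ?case by (simp add: v_def)
  qed
qed

lemma tail_bound:
  assumes aff: "affordable \<tau> w \<kappa>" and "0 \<le> \<kappa>"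
    and "filterlim u at_top at_top"
    and "\<forall>\<^sub>F x in at_top. 0 \<le> x' x \<and> x' x \<le> u x \<and> x \<le> u x \<and> u x - x' x \<le> w * (u x - x)"
    and A: "((\<lambda>x. f (x' x) / f x) \<longlongrightarrow> A) at_top" "0 < A" "A < 1"
    and B: "((\<lambda>x. f (u x) / f x) \<longlongrightarrow> B) at_top" "0 < B"
    and C: "\<kappa> * B / (1 - A) < C"
  shows "\<forall>\<^sub>F x in at_top. - ln (F x) \<le> C * f x"
proof -
  have "\<kappa> < C * (1 - A) / B" using A B C by (simp add: field_simps)
  then obtain \<kappa>' where \<kappa>': "\<kappa> < \<kappa>'" "\<kappa>' < C * (1 - A) / B" using dense by blast
  have "\<forall>\<^sub>F x in at_top. - ln (F x) \<le> - ln (F (x' x)) + \<kappa>' * f (u x)"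
    using aff \<kappa>'(1) assms(3,4) by (rule macro_step)
  moreover have "mono (\<lambda>x. - ln (F x))"
    using F_anti F_pos by (auto simp: mono_def antimono_def)
  moreover have "\<kappa>' * B / (1 - A) < C" using A B \<kappa>' by (simp add: field_simps)
  ultimately show ?thesis
    using f_mono f_top A B \<open>0 \<le> \<kappa>\<close> \<kappa>'(1) by (intro bound_by_descent[where u = u and x' = x'
      and A = A and B = B and \<kappa> = \<kappa>']) auto
qed

lemma tail_bound_regular:
  assumes f_ratio: "\<And>a. 0 < a \<Longrightarrow> ((\<lambda>x. f (a * x) / f x) \<longlongrightarrow> a powr G) at_top" and "0 < G"
    and ab: "0 < a" "a < 1" "1 < b" and "0 \<le> \<kappa>"
    and aff: "affordable \<tau> ((b - a) / (b - 1)) \<kappa>"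
    and C: "\<kappa> * b powr G / (1 - a powr G) < C"
  shows "\<forall>\<^sub>F x in at_top. - ln (F x) \<le> C * f x"
proof (rule tail_bound[OF aff \<open>0 \<le> \<kappa>\<close>])
  show "filterlim (\<lambda>x. b * x) at_top at_top"
    using ab by (intro filterlim_tendsto_pos_mult_at_top[OF tendsto_const] filterlim_ident) auto
  show "\<forall>\<^sub>F x in at_top. 0 \<le> a * x \<and> a * x \<le> b * x \<and> x \<le> b * x
      \<and> b * x - a * x \<le> (b - a) / (b - 1) * (b * x - x)"
    using eventually_ge_at_top[of 0]
  proof eventually_elim
    case (elim x)
    have "b * x - x = (b - 1) * x" by (simp add: algebra_simps)
    then have "(b - a) / (b - 1) * (b * x - x) = (b - a) * x" using ab by simp
    also have "\<dots> = b * x - a * x" by (simp add: algebra_simps)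
    finally show ?case
      using ab elim mult_right_mono[of 1 b x] mult_right_mono[of a b x] by simp
  qed
  show "((\<lambda>x. f (a * x) / f x) \<longlongrightarrow> a powr G) at_top" "((\<lambda>x. f (b * x) / f x) \<longlongrightarrow> b powr G) at_top"
    using ab by (auto intro: f_ratio)
  show "a powr G < 1" using ab \<open>0 < G\<close> powr_less_mono2[of G a 1] by simp
qed (use ab C in auto)

lemma tail_bound_Gamma:
  assumes g: "\<And>x. 0 < g x" and f_ratio: "\<And>s. ((\<lambda>x. f (x + s * g x) / f x) \<longlongrightarrow> exp s) at_top"
    and "0 < \<alpha>" "0 < \<beta>" "0 \<le> \<kappa>"
    and aff: "affordable \<tau> ((\<beta> + \<alpha>) / \<beta>) \<kappa>"
    and C: "\<kappa> * exp \<beta> / (1 - exp (- \<alpha>)) < C"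
  shows "\<forall>\<^sub>F x in at_top. - ln (F x) \<le> C * f x"
proof (rule tail_bound[OF aff \<open>0 \<le> \<kappa>\<close>])
  show "filterlim (\<lambda>x. x + \<beta> * g x) at_top at_top"
    using g \<open>0 < \<beta>\<close>
    by (intro filterlim_at_top_mono[OF filterlim_ident]) (auto intro!: always_eventually less_imp_le)
  show lim: "((\<lambda>x. f (x + (- \<alpha>) * g x) / f x) \<longlongrightarrow> exp (- \<alpha>)) at_top"
    and "((\<lambda>x. f (x + \<beta> * g x) / f x) \<longlongrightarrow> exp \<beta>) at_top"
    by (rule f_ratio)+
  \<comment> \<open>The lower level is eventually nonnegative, as \<open>f\<close> tends to infinity along it.\<close>
  have "filterlim (\<lambda>x. f (x + (- \<alpha>) * g x) / f x * f x) at_top at_top"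
    by (rule filterlim_tendsto_pos_mult_at_top[OF lim _ f_top]) simp
  then have "\<forall>\<^sub>F x in at_top. f 0 < f (x + (- \<alpha>) * g x) / f x * f x"
    by (simp add: filterlim_at_top_dense)
  moreover have "\<forall>\<^sub>F x in at_top. 0 < f x"
    using f_top by (simp add: filterlim_at_top_dense)
  ultimately show "\<forall>\<^sub>F x in at_top. 0 \<le> x + (- \<alpha>) * g x \<and> x + (- \<alpha>) * g x \<le> x + \<beta> * g x
      \<and> x \<le> x + \<beta> * g x
      \<and> x + \<beta> * g x - (x + (- \<alpha>) * g x) \<le> (\<beta> + \<alpha>) / \<beta> * (x + \<beta> * g x - x)"
  proof eventually_elim
    case (elim x)
    then have "f 0 < f (x + (- \<alpha>) * g x)" by simp
    then have "0 \<le> x + (- \<alpha>) * g x"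
      using monoD[OF f_mono, of "x + (- \<alpha>) * g x" 0] by linarith
    moreover have "0 \<le> \<alpha> * g x" "0 \<le> \<beta> * g x"
      using g[of x] \<open>0 < \<alpha>\<close> \<open>0 < \<beta>\<close> by auto
    moreover have "(\<beta> + \<alpha>) / \<beta> * (x + \<beta> * g x - x) = (\<beta> + \<alpha>) * g x"
      using \<open>0 < \<beta>\<close> by simp
    ultimately show ?case by (simp add: algebra_simps)
  qed
qed (use \<open>0 < \<alpha>\<close> C in auto)

end

section \<open>Optimal parameters\<close>

text \<open>
  Put \<open>q = 1 - 1 / t\<close>. A single step from \<open>a * x\<close> aimed at \<open>b * x\<close> reaches \<open>x\<close> if
  \<open>q * a + b / t = 1\<close>. The values \<open>a = q powr (1 / (G - 1))\<close> and
  \<open>b = t * (1 - q powr (G / (G - 1)))\<close> minimise \<open>b powr G / (t * (1 - a powr G))\<close> under this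
  constraint, with minimum \<open>b powr (G - 1)\<close>. Increasing \<open>b\<close> and the price \<open>1 / t\<close>
  by a small \<open>d\<close> makes the inequalities strict.
\<close>
lemma parameters_finite_gt_1:
  fixes t G C :: real
  assumes "1 < t" "1 < G" and C: "(t * (1 - (1 - 1 / t) powr (G / (G - 1)))) powr (G - 1) < C"
  obtains a b \<kappa> where "0 < a" "a < 1" "1 < b" "(b - a) / (b - 1) * (1 - 1 / t) < 1" "1 / t < \<kappa>"
    "\<kappa> * b powr G / (1 - a powr G) < C"
proof -
  define q where "q = 1 - 1 / t"
  have q: "0 < q" "q < 1" "t * (1 - q) = 1" using assms by (auto simp: q_def)
  define r where "r = q powr (G / (G - 1))"
  define a where "a = q powr (1 / (G - 1))"
  define b where "b = t * (1 - r)"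
  have "1 < G / (G - 1)" using assms by simp
  then have "r < q powr 1" unfolding r_def using q by (intro powr_less_mono') auto
  then have r: "0 < r" "r < q" using q by (auto simp: r_def)
  have a: "0 < a" "a < 1" using q assms powr_less_mono2[of "1 / (G - 1)" q 1] by (auto simp: a_def)
  have "1 < b" using mult_strict_left_mono[of "1 - q" "1 - r" t] r q assms by (simp add: b_def)
  have aG: "a powr G = r" by (simp add: a_def r_def powr_powr)
  have "G / (G - 1) = 1 + 1 / (G - 1)" using assms by (simp add: field_simps)
  then have r_eq: "r = q * a" using q unfolding r_def a_def by (simp only: powr_add) simp
  have q_eq: "(b - a) * q = b - 1"
  proof -
    have "t * q = t - 1" using q(3) by (simp add: algebra_simps)
    have "(b - a) * q = t * q * (1 - r) - r" by (simp add: b_def r_eq algebra_simps)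
    also have "\<dots> = b - 1" unfolding \<open>t * q = t - 1\<close> by (simp add: b_def algebra_simps)
    finally show ?thesis .
  qed
  have val: "1 / t * b powr G / (1 - a powr G) < C"
  proof -
    have "b powr G = b powr (G - 1) * b"
      using \<open>1 < b\<close> by (simp add: powr_diff)
    then have "1 / t * b powr G / (1 - a powr G) = b powr (G - 1)"
      using r q assms by (simp add: aG b_def)
    with C show ?thesis by (simp add: b_def r_def q_def)
  qed
  have "((\<lambda>d. (1 / t + d) * (b + d) powr G / (1 - a powr G)) \<longlongrightarrow> (1 / t + 0) * (b + 0) powr G / (1 - a powr G)) (at_right 0)"
    using \<open>1 < b\<close> aG r q by (intro tendsto_intros) auto
  then have "\<forall>\<^sub>F d in at_right 0. (1 / t + d) * (b + d) powr G / (1 - a powr G) < C"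
    using val by (intro order_tendstoD(2)) auto
  moreover have "\<forall>\<^sub>F d in at_right (0::real). 0 < d" by (rule eventually_at_right_less)
  ultimately have "\<forall>\<^sub>F d in at_right (0::real). 0 < d \<and> (1 / t + d) * (b + d) powr G / (1 - a powr G) < C"
    by eventually_elim auto
  from eventually_happens[OF this] obtain d where d: "0 < d" "(1 / t + d) * (b + d) powr G / (1 - a powr G) < C"
    by auto
  have "d * q < d" using q d by simp
  then have "(b + d - a) * q < b + d - 1"
    using q_eq by (simp add: algebra_simps)
  then have "(b + d - a) / (b + d - 1) * q < 1" using \<open>1 < b\<close> d by (simp add: field_simps)
  then show ?thesis
    using a \<open>1 < b\<close> d by (intro that[of a "b + d" "1 / t + d"]) (auto simp: q_def)
qed

text \<open>
  For index 1 the infimum is approached as the starting level \<open>a * x\<close> tends to 0: one step with target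
  \<open>t * x\<close> then does all the work.
\<close>
lemma parameters_finite_1:
  fixes t C :: real
  assumes "1 < t" "1 < C"
  obtains a \<kappa> where "0 < a" "a < 1" "(t - a) / (t - 1) * (1 - 1 / t) < 1" "1 / t < \<kappa>"
    "\<kappa> * t / (1 - a) < C"
proof -
  have "((\<lambda>d. (1 / t + d) * t / (1 - d)) \<longlongrightarrow> (1 / t + 0) * t / (1 - 0)) (at_right 0)"
    by (intro tendsto_intros) auto
  then have "\<forall>\<^sub>F d in at_right 0. (1 / t + d) * t / (1 - d) < C"
    using assms by (intro order_tendstoD(2)) auto
  moreover have "\<forall>\<^sub>F d in at_right (0::real). d \<in> {0<..<1}" by (rule eventually_at_right_real) simp
  ultimately have "\<forall>\<^sub>F d in at_right (0::real). 0 < d \<and> d < 1 \<and> (1 / t + d) * t / (1 - d) < C"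
    by eventually_elim auto
  from eventually_happens[OF this] obtain d where d: "0 < d" "d < 1" "(1 / t + d) * t / (1 - d) < C"
    by auto
  have "(t - d) / (t - 1) * (1 - 1 / t) = (t - d) / t" using assms by (simp add: field_simps)
  then show ?thesis
    using d assms by (intro that[of d "1 / t + d"]) auto
qed

text \<open>
  For \<open>a = 1 - d\<close> with \<open>d \<rightarrow> 0\<close> the constant becomes \<open>b powr G / (G * (b - 1))\<close>, the cost of a
  continuous ascent that always aims at \<open>b\<close> times the current level. It is minimal at \<open>b = G / (G - 1)\<close>.
  The price \<open>d / (b - 1)\<close> is a linear upper bound for the logarithm of the distance ratio.
\<close>
lemma parameters_infinite_gt_1:
  fixes G C :: real
  assumes "1 < G" and C: "(G / (G - 1)) powr (G - 1) < C"
  obtains a b \<kappa> where "0 < a" "a < 1" "1 < b" "ln ((b - a) / (b - 1)) < \<kappa>" "0 \<le> \<kappa>"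
    "\<kappa> * b powr G / (1 - a powr G) < C"
proof -
  define b where "b = G / (G - 1)"
  have b: "1 < b" using assms by (simp add: b_def)
  have b1: "1 / (b - 1) = G - 1" using assms by (simp add: b_def field_simps)
  have "((\<lambda>d. (1 - (1 - d) powr G) / d) \<longlongrightarrow> G) (at_right 0)"
    using assms by real_asymp
  then have "((\<lambda>d. (G - 1) * b powr G / ((1 - (1 - d) powr G) / d)) \<longlongrightarrow> (G - 1) * b powr G / G) (at_right 0)"
    using assms by (intro tendsto_intros) auto
  moreover have "(G - 1) * b powr G / G = b powr (G - 1)"
    using assms b by (simp add: powr_diff) (simp add: b_def)
  ultimately have "\<forall>\<^sub>F d in at_right 0. (G - 1) * b powr G / ((1 - (1 - d) powr G) / d) < C"
    using C by (intro order_tendstoD(2)) (auto simp: b_def)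
  moreover have "\<forall>\<^sub>F d in at_right (0::real). d \<in> {0<..<1}" by (rule eventually_at_right_real) simp
  ultimately have "\<forall>\<^sub>F d in at_right (0::real). 0 < d \<and> d < 1 \<and> (G - 1) * b powr G / ((1 - (1 - d) powr G) / d) < C"
    by eventually_elim auto
  from eventually_happens[OF this] obtain d where d: "0 < d" "d < 1"
      "(G - 1) * b powr G / ((1 - (1 - d) powr G) / d) < C"
    by auto
  have "(b - (1 - d)) / (b - 1) = 1 + d * (1 / (b - 1))"
    using b by (simp add: field_simps)
  then have "(b - (1 - d)) / (b - 1) = 1 + d * (G - 1)"
    by (simp only: b1)
  moreover have "ln (1 + d * (G - 1)) < d * (G - 1)"
  proof -
    have "0 < d * (G - 1)" using d assms by simp
    then have "ln (1 + d * (G - 1)) \<noteq> d * (G - 1)"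
      using ln_eq_minus_one[of "1 + d * (G - 1)"] by auto
    with ln_add_one_self_le_self[of "d * (G - 1)"] \<open>0 < d * (G - 1)\<close> show ?thesis by auto
  qed
  ultimately show ?thesis
    using d b assms by (intro that[of "1 - d" b "d * (G - 1)"]) (auto simp: mult_ac)
qed

text \<open>
  For index 1 the cost of a continuous ascent aimed at \<open>b\<close> times the current level is \<open>b / (b - 1)\<close>,
  which tends to 1 for large \<open>b\<close>. Since \<open>1 - a powr 1\<close> is linear in \<open>a\<close>, the linear bound for the
  logarithm gives this value for every \<open>a\<close>, in particular for \<open>a = 1 / 2\<close>.
\<close>
lemma parameters_infinite_1:
  fixes C :: real
  assumes "1 < C"
  obtains a b \<kappa> where "0 < a" "a < 1" "1 < b" "ln ((b - a) / (b - 1)) < \<kappa>" "0 \<le> \<kappa>"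
    "\<kappa> * b / (1 - a) < C"
proof -
  define b where "b = C / (C - 1) + 1"
  have b: "1 < b" using assms by (simp add: b_def)
  define \<kappa> where "\<kappa> = 1 / (2 * (b - 1))"
  have "0 < \<kappa>" using b by (simp add: \<kappa>_def)
  then have "ln (1 + \<kappa>) \<noteq> \<kappa>"
    using ln_eq_minus_one[of "1 + \<kappa>"] by auto
  with ln_add_one_self_le_self[of \<kappa>] \<open>0 < \<kappa>\<close> have "ln (1 + \<kappa>) < \<kappa>" by auto
  moreover have "(b - 1 / 2) / (b - 1) = 1 + \<kappa>" using b by (simp add: \<kappa>_def field_simps)
  moreover have "\<kappa> * b / (1 - 1 / 2) = 1 + 1 / (b - 1)" using b by (simp add: \<kappa>_def field_simps)
  moreover have "1 + 1 / (b - 1) < C"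
  proof -
    have "1 / (b - 1) = (C - 1) / C" using assms by (simp add: b_def)
    also have "\<dots> < (C - 1) / 1" using assms by (intro divide_strict_left_mono) auto
    finally show ?thesis by simp
  qed
  ultimately show ?thesis
    using b \<open>0 < \<kappa>\<close> by (intro that[of "1 / 2" b \<kappa>]) auto
qed

text \<open>
  The constraint \<open>\<beta> > (t - 1) * \<alpha>\<close> leaves room for \<open>\<beta> = t * \<alpha>\<close>. With \<open>\<alpha> = ln (1 + 1 / t)\<close> one has
  \<open>1 - exp (- \<alpha>) = 1 / (t + 1)\<close>, and the price \<open>1 / t\<close> yields exactly \<open>(1 + 1 / t) powr (1 + t)\<close>.
\<close>
lemma parameters_Gamma_finite:
  fixes t C :: real
  assumes "1 < t" and C: "(1 + 1 / t) powr (1 + t) < C"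
  obtains \<alpha> \<beta> \<kappa> where "0 < \<alpha>" "0 < \<beta>" "(\<beta> + \<alpha>) / \<beta> * (1 - 1 / t) < 1" "1 / t < \<kappa>"
    "\<kappa> * exp \<beta> / (1 - exp (- \<alpha>)) < C"
proof -
  define \<alpha> where "\<alpha> = ln (1 + 1 / t)"
  have \<alpha>: "0 < \<alpha>" unfolding \<alpha>_def using assms by (intro ln_gt_zero) simp
  have exp_\<alpha>: "1 - exp (- \<alpha>) = 1 / (t + 1)" using assms by (simp add: \<alpha>_def exp_minus field_simps add_pos_pos)
  have "1 + 1 / t \<noteq> 0" using assms by (intro less_imp_neq[symmetric] add_pos_pos) auto
  then have "exp (t * \<alpha>) = (1 + 1 / t) powr t"
    by (simp add: \<alpha>_def powr_def)
  moreover have "(1 + 1 / t) powr (1 + t) = (1 + 1 / t) * (1 + 1 / t) powr t"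
    using assms by (simp add: powr_add add_pos_pos)
  moreover have "1 / t * y / (1 / (t + 1)) = (1 + 1 / t) * y" for y
    using assms by (simp add: field_simps)
  ultimately have val: "1 / t * exp (t * \<alpha>) / (1 - exp (- \<alpha>)) < C"
    unfolding exp_\<alpha> using C by simp
  have "((\<lambda>d. (1 / t + d) * exp (t * \<alpha>) / (1 - exp (- \<alpha>))) \<longlongrightarrow> (1 / t + 0) * exp (t * \<alpha>) / (1 - exp (- \<alpha>))) (at_right 0)"
    using \<alpha> by (intro tendsto_intros) auto
  then have "\<forall>\<^sub>F d in at_right 0. (1 / t + d) * exp (t * \<alpha>) / (1 - exp (- \<alpha>)) < C"
    using val by (intro order_tendstoD(2)) auto
  moreover have "\<forall>\<^sub>F d in at_right (0::real). 0 < d" by (rule eventually_at_right_less)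
  ultimately have "\<forall>\<^sub>F d in at_right 0. 0 < d \<and> (1 / t + d) * exp (t * \<alpha>) / (1 - exp (- \<alpha>)) < C"
    by eventually_elim auto
  from eventually_happens[OF this] obtain d where d: "0 < d" "(1 / t + d) * exp (t * \<alpha>) / (1 - exp (- \<alpha>)) < C"
    by auto
  have "(t * \<alpha> + \<alpha>) / (t * \<alpha>) * (1 - 1 / t) = 1 - (1 / t) ^ 2"
    using assms \<alpha> by (simp add: field_simps power2_eq_square)
  also have "\<dots> < 1" using assms by simp
  finally show ?thesis
    using d assms \<alpha> by (intro that[of \<alpha> "t * \<alpha>" "1 / t + d"]) auto
qed

text \<open>
  A continuous ascent aimed at \<open>x + \<beta> * g x\<close> costs \<open>exp \<beta> / \<beta>\<close>, which is minimal at \<open>\<beta> = 1\<close>; it is the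
  limit of blocks with \<open>\<alpha> \<rightarrow> 0\<close>.
\<close>
lemma parameters_Gamma_infinite:
  fixes C :: real
  assumes "exp 1 < C"
  obtains \<alpha> where "0 < \<alpha>" "ln (1 + \<alpha>) < \<alpha>" "\<alpha> * exp 1 / (1 - exp (- \<alpha>)) < C"
proof -
  have "((\<lambda>d. d * exp 1 / (1 - exp (- d))) \<longlongrightarrow> exp (1::real)) (at_right 0)"
    by real_asymp
  then have "\<forall>\<^sub>F d in at_right 0. d * exp 1 / (1 - exp (- d)) < C"
    using assms by (intro order_tendstoD(2)) auto
  moreover have "\<forall>\<^sub>F d in at_right (0::real). 0 < d" by (rule eventually_at_right_less)
  ultimately have "\<forall>\<^sub>F d in at_right 0. 0 < d \<and> d * exp 1 / (1 - exp (- d)) < C"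
    by eventually_elim auto
  from eventually_happens[OF this] obtain d :: real where d: "0 < d" "d * exp 1 / (1 - exp (- d)) < C"
    by auto
  then have "ln (1 + d) \<noteq> d"
    using ln_eq_minus_one[of "1 + d"] by auto
  with ln_add_one_self_le_self[of d] d show ?thesis by (intro that[of d]) auto
qed

section \<open>Perpetuities\<close>

text \<open>
  The law of \<open>R\<close> is that of \<open>M * R + Q\<close> under the product measure, and \<open>M * R + Q\<close> exceeds \<open>v\<close>
  on the rectangle where \<open>R > x\<close>, \<open>1 - 1 / t < M < 1\<close> and \<open>Q > y\<close>.
\<close>
lemma perpetuity_tail_step:
  assumes "prob_space P" and [measurable]: "M \<in> borel_measurable P" "Q \<in> borel_measurable P"
    and M: "AE \<omega> in P. 0 \<le> M \<omega> \<and> M \<omega> < 1"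
    and R: "is_perpetuity P M Q N R"
    and "1 \<le> t" and v: "v \<le> x + y" "v \<le> (1 - 1 / t) * x + y"
  shows "\<P>(\<omega> in N. R \<omega> > x) * \<P>(\<omega> in P. 1 / (1 - M \<omega>) > t \<and> Q \<omega> > y) \<le> \<P>(\<omega> in N. R \<omega> > v)"
proof -
  interpret P: prob_space P by fact
  interpret N: prob_space N using R by (simp add: is_perpetuity_def)
  interpret PN: pair_prob_space P N ..
  have [measurable]: "R \<in> borel_measurable N" using R by (simp add: is_perpetuity_def)
  define A where "A = {\<omega> \<in> space P. (0 \<le> M \<omega> \<and> M \<omega> < 1) \<and> 1 / (1 - M \<omega>) > t \<and> Q \<omega> > y}"
  define B where "B = {\<omega> \<in> space N. R \<omega> > x}"
  have [measurable]: "A \<in> sets P" "B \<in> sets N" by (auto simp: A_def B_def)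
  have "\<P>(\<omega> in P. 1 / (1 - M \<omega>) > t \<and> Q \<omega> > y) = measure P A"
    unfolding A_def using M by (intro P.finite_measure_eq_AE) auto
  then have "\<P>(\<omega> in N. R \<omega> > x) * \<P>(\<omega> in P. 1 / (1 - M \<omega>) > t \<and> Q \<omega> > y)
      = measure (P \<Otimes>\<^sub>M N) (A \<times> B)"
    by (simp add: measure_def N.emeasure_pair_measure_Times enn2real_mult B_def[symmetric])
  also have "\<dots> \<le> measure (P \<Otimes>\<^sub>M N) {z \<in> space (P \<Otimes>\<^sub>M N). (case z of (\<omega>, \<omega>') \<Rightarrow> M \<omega> * R \<omega>' + Q \<omega>) > v}"
  proof (intro PN.finite_measure_mono subsetI)
    fix z assume "z \<in> A \<times> B"
    then obtain \<omega> \<omega>' where z: "z = (\<omega>, \<omega>')" "\<omega> \<in> A" "\<omega>' \<in> B" by auto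
    then have "0 \<le> M \<omega>" "M \<omega> < 1" "t < 1 / (1 - M \<omega>)" "y < Q \<omega>" "x < R \<omega>'"
      by (auto simp: A_def B_def)
    have "1 - 1 / t < M \<omega>"
      using \<open>t < 1 / (1 - M \<omega>)\<close> \<open>M \<omega> < 1\<close> \<open>1 \<le> t\<close> by (simp add: field_simps)
    have "v \<le> M \<omega> * x + y"
    proof (cases "0 \<le> x")
      case True
      then have "(1 - 1 / t) * x \<le> M \<omega> * x"
        using \<open>1 - 1 / t < M \<omega>\<close> by (intro mult_right_mono) auto
      with v show ?thesis by simp
    next
      case False
      then have "1 * x \<le> M \<omega> * x"
        using \<open>M \<omega> < 1\<close> by (intro mult_right_mono_neg) auto
      with v show ?thesis by simp
    qed
    also have "\<dots> < M \<omega> * R \<omega>' + Q \<omega>"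
      using \<open>0 \<le> M \<omega>\<close> \<open>x < R \<omega>'\<close> \<open>y < Q \<omega>\<close>
      by (intro add_le_less_mono mult_left_mono) auto
    finally show "z \<in> {z \<in> space (P \<Otimes>\<^sub>M N). (case z of (\<omega>, \<omega>') \<Rightarrow> M \<omega> * R \<omega>' + Q \<omega>) > v}"
      using z by (auto simp: space_pair_measure A_def B_def)
  qed measurable
  also have "\<dots> = measure (distr (P \<Otimes>\<^sub>M N) borel (\<lambda>(\<omega>, \<omega>'). M \<omega> * R \<omega>' + Q \<omega>)) {v<..}"
    by (subst measure_distr) (auto intro!: arg_cong[where f = "measure _"])
  also have "distr (P \<Otimes>\<^sub>M N) borel (\<lambda>(\<omega>, \<omega>'). M \<omega> * R \<omega>' + Q \<omega>) = distr N borel R"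
    using R by (simp add: is_perpetuity_def)
  also have "measure (distr N borel R) {v<..} = \<P>(\<omega> in N. R \<omega> > v)"
    by (subst measure_distr) (auto intro!: arg_cong[where f = "measure _"])
  finally show ?thesis .
qed

lemma neg_log_nonneg: "0 \<le> p \<Longrightarrow> p \<le> 1 \<Longrightarrow> 0 \<le> neg_log p"
  by (auto simp: neg_log_def)

lemma neg_log_antimono: "0 \<le> p \<Longrightarrow> p \<le> p' \<Longrightarrow> neg_log p' \<le> neg_log p"
  by (auto simp: neg_log_def)

lemma perp_rate_nonneg:
  assumes "prob_space P"
  shows "0 \<le> perp_rate P M Q x"
  unfolding perp_rate_def perp_cost_def
  using assms by (intro INF_greatest ereal_0_le_mult neg_log_nonneg) (auto simp: prob_space.prob_le_1)

lemma mono_perp_rate: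
  assumes "prob_space P" and [measurable]: "M \<in> borel_measurable P" "Q \<in> borel_measurable P"
  shows "mono (perp_rate P M Q)"
proof (rule monoI)
  fix x y :: real assume "x \<le> y"
  interpret prob_space P by fact
  show "perp_rate P M Q x \<le> perp_rate P M Q y"
    unfolding perp_rate_def
  proof (rule INF_mono)
    fix t :: real assume t: "t \<in> {1..}"
    have "x / t \<le> y / t" using \<open>x \<le> y\<close> t by (intro divide_right_mono) auto
    then have "perp_cost P M Q t x \<le> perp_cost P M Q t y"
      unfolding perp_cost_def using t
      by (intro ereal_mult_left_mono neg_log_antimono finite_measure_mono) auto
    with t show "\<exists>s\<in>{1..}. perp_cost P M Q s x \<le> perp_cost P M Q t y" by auto
  qed
qed

text \<open>This makes the rate function unbounded both for regular variation of index at least 1 and for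
  rapid variation.\<close>
lemma filterlim_at_top_of_doubling:
  fixes f :: "real \<Rightarrow> real"
  assumes "mono f" and pos: "\<forall>\<^sub>F x in at_top. 0 < f x"
    and "1 < c" and growth: "\<forall>\<^sub>F x in at_top. c * f x \<le> f (2 * x)"
  shows "filterlim f at_top at_top"
proof -
  have "\<forall>\<^sub>F x in at_top. 1 \<le> x \<and> 0 < f x \<and> c * f x \<le> f (2 * x)"
    using pos growth eventually_ge_at_top[of 1] by eventually_elim auto
  then obtain X where X: "\<And>x. X \<le> x \<Longrightarrow> 1 \<le> x \<and> 0 < f x \<and> c * f x \<le> f (2 * x)"
    unfolding eventually_at_top_linorder by auto
  have X1: "1 \<le> X" "0 < f X" using X[of X] by auto
  have iter: "c ^ n * f X \<le> f (2 ^ n * X)" for n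
  proof (induction n)
    case (Suc n)
    have "c ^ Suc n * f X \<le> c * f (2 ^ n * X)"
      using Suc \<open>1 < c\<close> by simp
    also have "\<dots> \<le> f (2 * (2 ^ n * X))"
      using X[of "2 ^ n * X"] X1 mult_right_mono[of 1 "2 ^ n" X] by auto
    finally show ?case by (simp add: mult_ac)
  qed simp
  show ?thesis
    unfolding filterlim_at_top eventually_at_top_linorder
  proof
    fix Z :: real
    obtain n where "Z / f X < c ^ n" using real_arch_pow[OF \<open>1 < c\<close>] by blast
    then have "Z \<le> c ^ n * f X" using X1 by (simp add: field_simps)
    also have "\<dots> \<le> f (2 ^ n * X)" by (rule iter)
    finally have "Z \<le> f x" if "2 ^ n * X \<le> x" for x
      using monoD[OF \<open>mono f\<close> that] by linarith
    then show "\<exists>x0. \<forall>x\<ge>x0. Z \<le> f x" by blast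
  qed
qed

theorem theorem5p1:
  fixes P :: "'a measure" and M Q :: "'a \<Rightarrow> real"
    and N :: "'b measure" and R :: "'b \<Rightarrow> real"
    and h :: "real \<Rightarrow> ereal" and \<gamma> :: ereal
    and \<tau> :: "real \<Rightarrow> real" and t_inf :: ereal
  assumes "prob_space P"
    and "M \<in> borel_measurable P" and "Q \<in> borel_measurable P"
    and "AE \<omega> in P. 0 \<le> M \<omega> \<and> M \<omega> < 1"
    and "AE \<omega> in P. 0 \<le> Q \<omega>"
    and "\<And>z::real. integrable P (\<lambda>\<omega>. exp (z * Q \<omega>))"
    and "is_perpetuity P M Q N R"
    and h_def: "h = perp_rate P M Q"
    and h_finite: "\<forall>\<^sub>F x in at_top. \<bar>h x\<bar> \<noteq> \<infinity>"
    and "1 \<le> \<gamma>"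
    and "\<gamma> < \<infinity> \<Longrightarrow> (\<lambda>x. real_of_ereal (h x)) \<in> regularly_varying (real_of_ereal \<gamma>)"
    and "\<gamma> = \<infinity> \<Longrightarrow> (\<lambda>x. real_of_ereal (h x)) \<in> rapidly_varying \<inter> class_Gamma"
    and "\<And>x. 1 \<le> \<tau> x"
    and "((\<lambda>x. h x - perp_cost P M Q (\<tau> x) x) \<longlongrightarrow> 0) at_top"
    and "((\<lambda>x. ereal (\<tau> x)) \<longlongrightarrow> t_inf) at_top"
    and "1 < t_inf"
  shows "Liminf at_top (\<lambda>x. ext_log (\<P>(\<omega> in N. R \<omega> > x)) / h x)
           \<ge> - ereal (perp_const t_inf \<gamma>)"
proof -
  interpret P: prob_space P by fact
  note [measurable] = \<open>M \<in> borel_measurable P\<close> \<open>Q \<in> borel_measurable P\<close>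
  have N: "prob_space N" and R[measurable]: "R \<in> borel_measurable N"
    using \<open>is_perpetuity P M Q N R\<close> by (simp_all add: is_perpetuity_def)
  interpret N: prob_space N by fact
  define F where "F x = \<P>(\<omega> in N. R \<omega> > x)" for x
  define \<pi> where "\<pi> u = \<P>(\<omega> in P. 1 / (1 - M \<omega>) > \<tau> u \<and> Q \<omega> > u / \<tau> u)" for u
  define f where "f x = real_of_ereal (h x)" for x
  have h_mono: "mono h"
    unfolding h_def by (rule mono_perp_rate) fact+
  have h_nonneg: "0 \<le> h x" for x
    unfolding h_def by (rule perp_rate_nonneg) fact
  \<comment> \<open>By monotonicity, finiteness near infinity gives finiteness everywhere.\<close>
  have h_eq: "h x = ereal (f x)" for x
  proof -
    have "\<forall>\<^sub>F y in at_top. x \<le> y \<and> \<bar>h y\<bar> \<noteq> \<infinity>"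
      using h_finite eventually_ge_at_top[of x] by eventually_elim auto
    from eventually_happens[OF this] obtain y where "x \<le> y" "\<bar>h y\<bar> \<noteq> \<infinity>" by auto
    with monoD[OF h_mono \<open>x \<le> y\<close>] h_nonneg[of x] show ?thesis
      unfolding f_def by (cases "h x"; cases "h y") auto
  qed
  have f_mono: "mono f" using h_mono by (auto simp: mono_def h_eq)
  have f_nonneg: "0 \<le> f x" for x using h_nonneg[of x] by (simp add: h_eq)
  have f_top: "filterlim f at_top at_top"
  proof (cases "\<gamma> = \<infinity>")
    case True
    then have "f \<in> rapidly_varying" using assms(12) by (simp add: f_def[abs_def])
    then have "filterlim (\<lambda>x. f (2 * x) / f x) at_top at_top"
      by (simp add: rapidly_varying_def)
    then have ev: "\<forall>\<^sub>F x in at_top. 2 \<le> f (2 * x) / f x"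
      by (simp add: filterlim_at_top)
    have pos: "\<forall>\<^sub>F x in at_top. 0 < f x"
      using ev
    proof eventually_elim
      case (elim x)
      then have "f x \<noteq> 0" by auto
      then show ?case using f_nonneg[of x] by simp
    qed
    moreover have "\<forall>\<^sub>F x in at_top. 2 * f x \<le> f (2 * x)"
      using ev pos by eventually_elim (simp add: field_simps)
    ultimately show ?thesis
      by (intro filterlim_at_top_of_doubling[OF f_mono, of 2]) auto
  next
    case False
    define G where "G = real_of_ereal \<gamma>"
    have G: "\<gamma> = ereal G" "1 \<le> G" using False \<open>1 \<le> \<gamma>\<close> by (cases \<gamma>; auto simp: G_def)+
    then have "f \<in> regularly_varying G" using assms(11) by (simp add: f_def[abs_def])
    then have pos: "\<forall>\<^sub>F x in at_top. 0 < f x"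
      and lim: "((\<lambda>x. f (2 * x) / f x) \<longlongrightarrow> 2 powr G) at_top"
      by (auto simp: regularly_varying_def)
    \<comment> \<open>The limit is at least 2, so any factor in between 1 and 2 will do.\<close>
    have "2 powr 1 \<le> (2::real) powr G" using G by (intro powr_mono) auto
    then have "\<forall>\<^sub>F x in at_top. 3 / 2 < f (2 * x) / f x"
      by (intro order_tendstoD(1)[OF lim]) auto
    with pos have "\<forall>\<^sub>F x in at_top. 3 / 2 * f x \<le> f (2 * x)"
      by eventually_elim (simp add: field_simps)
    with pos show ?thesis
      by (intro filterlim_at_top_of_doubling[OF f_mono, of "3 / 2"]) auto
  qed
  interpret perpetuity_tail F \<pi> \<tau> f
  proof
    show "antimono F"
      unfolding F_def by (intro antimonoI N.finite_measure_mono) auto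
    show "\<exists>x. 0 < F x"
    proof (rule ccontr)
      assume "\<not> ?thesis"
      then have "F (- real n) = 0" for n
        using measure_nonneg[of N] by (auto simp: F_def not_less intro: antisym)
      then have "AE \<omega> in N. \<not> R \<omega> > - real n" for n
        using N.prob_Collect_eq_0[of "\<lambda>\<omega>. R \<omega> > - real n"] by (simp add: F_def)
      then have "AE \<omega> in N. \<forall>n. \<not> R \<omega> > - real n" by (simp add: AE_all_countable)
      then have "AE \<omega> in N. False"
      proof eventually_elim
        case (elim \<omega>)
        obtain n where "- R \<omega> < real n" using reals_Archimedean2 by blast
        then have "- real n < R \<omega>" by simp
        with elim show False by blast
      qed
      then show False using N.AE_False by simp
    qed
    show "1 \<le> \<tau> u" for u by fact
    show "F x * \<pi> u \<le> F v"
      if "v \<le> x + u / \<tau> u" "v \<le> (1 - 1 / \<tau> u) * x + u / \<tau> u" for v x u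
      unfolding F_def \<pi>_def using that assms(13)[of u] assms(1-4,7)
      by (intro perpetuity_tail_step)
    show "\<forall>\<^sub>F u in at_top. 0 < \<pi> u \<and> - \<tau> u * ln (\<pi> u) \<le> f u + 1"
    proof -
      have "\<forall>\<^sub>F u in at_top. - 1 < h u - perp_cost P M Q (\<tau> u) u"
        using assms(14) by (rule order_tendstoD(1)) (simp add: zero_ereal_def one_ereal_def)
      then show ?thesis
      proof eventually_elim
        case (elim u)
        then have *: "- 1 < ereal (f u) - ereal (\<tau> u) * neg_log (\<pi> u)"
          by (simp add: h_eq perp_cost_def \<pi>_def)
        have "1 \<le> \<tau> u" by fact
        then have "\<pi> u \<noteq> 0" using * by (auto simp: neg_log_def)
        moreover have "0 \<le> \<pi> u" by (simp add: \<pi>_def)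
        ultimately show ?case using * by (auto simp: neg_log_def one_ereal_def)
      qed
    qed
    show "mono f" "filterlim f at_top at_top" by fact+
  qed
  have bound: "\<forall>\<^sub>F x in at_top. - ln (F x) \<le> C * f x" if C: "perp_const t_inf \<gamma> < C" for C
  proof -
    have \<tau>_inf: "filterlim \<tau> at_top at_top" if "t_inf = \<infinity>"
      using assms(15) that by (simp add: tendsto_PInfty_eq_at_top)
    have \<tau>_fin: "(\<tau> \<longlongrightarrow> s) at_top" if "t_inf = ereal s" for s
      using assms(15) that by simp
    have t_cases: "t_inf = \<infinity> \<or> (\<exists>s>1. t_inf = ereal s)"
      using \<open>1 < t_inf\<close> by (cases t_inf) (auto simp: one_ereal_def)
    show ?thesis
    proof (cases "\<gamma> = \<infinity>")
      case True
      then have "f \<in> class_Gamma" using assms(12) by (simp add: f_def[abs_def])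
      then obtain g where g: "\<And>x. 0 < g x"
          "\<And>s. ((\<lambda>x. f (x + s * g x) / f x) \<longlongrightarrow> exp s) at_top"
        by (auto simp: class_Gamma_def)
      from t_cases show ?thesis
      proof (elim disjE exE conjE)
        assume t: "t_inf = \<infinity>"
        with C True have "exp 1 < C" by (simp add: perp_const_def)
        from parameters_Gamma_infinite[OF this] obtain \<alpha> where
          \<alpha>: "0 < \<alpha>" "ln (1 + \<alpha>) < \<alpha>" "\<alpha> * exp 1 / (1 - exp (- \<alpha>)) < C" .
        with \<tau>_inf[OF t] have "affordable \<tau> ((1 + \<alpha>) / 1) \<alpha>"
          by (intro affordable_infinite) auto
        with \<alpha> show ?thesis
          by (intro tail_bound_Gamma[OF g, of \<alpha> 1 \<alpha>]) auto
      next
        fix s :: real assume t: "1 < s" "t_inf = ereal s"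
        with C True have "(1 + 1 / s) powr (1 + s) < C" by (simp add: perp_const_def)
        from parameters_Gamma_finite[OF \<open>1 < s\<close> this] obtain \<alpha> \<beta> \<kappa> where
          *: "0 < \<alpha>" "0 < \<beta>" "(\<beta> + \<alpha>) / \<beta> * (1 - 1 / s) < 1" "1 / s < \<kappa>"
            "\<kappa> * exp \<beta> / (1 - exp (- \<alpha>)) < C" .
        moreover have "0 \<le> \<kappa>" using * t order.trans[of 0 "1 / s" \<kappa>] by simp
        ultimately show ?thesis
          using \<tau>_fin[OF t(2)] t(1)
          by (intro tail_bound_Gamma[OF g, of \<alpha> \<beta> \<kappa>] affordable_finite) auto
      qed
    next
      case False
      define G where "G = real_of_ereal \<gamma>"
      have G: "\<gamma> = ereal G" "1 \<le> G" using False \<open>1 \<le> \<gamma>\<close> by (cases \<gamma>; auto simp: G_def)+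
      then have "f \<in> regularly_varying G" using assms(11) by (simp add: f_def[abs_def])
      then have ratio: "((\<lambda>x. f (a * x) / f x) \<longlongrightarrow> a powr G) at_top" if "0 < a" for a
        using that by (simp add: regularly_varying_def)
      from t_cases show ?thesis
      proof (elim disjE exE conjE)
        assume t: "t_inf = \<infinity>"
        obtain a b \<kappa> where *: "0 < a" "a < 1" "1 < b" "ln ((b - a) / (b - 1)) < \<kappa>" "0 \<le> \<kappa>"
          "\<kappa> * b powr G / (1 - a powr G) < C"
        proof (cases "G = 1")
          case True
          with C G have "1 < C" by (simp add: perp_const_def)
          from parameters_infinite_1[OF this] obtain a b \<kappa> where
            "0 < a" "a < 1" "1 < b" "ln ((b - a) / (b - 1)) < \<kappa>" "0 \<le> \<kappa>" "\<kappa> * b / (1 - a) < C" .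
          then show ?thesis using True by (intro that[of a b \<kappa>]) auto
        next
          case False
          with C G t have "1 < G" "(G / (G - 1)) powr (G - 1) < C"
            by (simp_all add: perp_const_def one_ereal_def)
          from parameters_infinite_gt_1[OF this] show ?thesis using that by blast
        qed
        moreover have "affordable \<tau> ((b - a) / (b - 1)) \<kappa>"
          using \<tau>_inf[OF t] * by (intro affordable_infinite) auto
        ultimately show ?thesis using G
          by (intro tail_bound_regular[OF ratio, of a b \<kappa>]) auto
      next
        fix s :: real assume t: "1 < s" "t_inf = ereal s"
        obtain a b \<kappa> where *: "0 < a" "a < 1" "1 < b" "(b - a) / (b - 1) * (1 - 1 / s) < 1"
          "1 / s < \<kappa>" "\<kappa> * b powr G / (1 - a powr G) < C"
        proof (cases "G = 1")
          case True
          with C G have "1 < C" by (simp add: perp_const_def)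
          from parameters_finite_1[OF \<open>1 < s\<close> this] obtain a \<kappa> where
            "0 < a" "a < 1" "(s - a) / (s - 1) * (1 - 1 / s) < 1" "1 / s < \<kappa>" "\<kappa> * s / (1 - a) < C" .
          then show ?thesis using True \<open>1 < s\<close> by (intro that[of a s \<kappa>]) auto
        next
          case False
          with C G t have "1 < G" "(s * (1 - (1 - 1 / s) powr (G / (G - 1)))) powr (G - 1) < C"
            by (simp_all add: perp_const_def one_ereal_def)
          from parameters_finite_gt_1[OF \<open>1 < s\<close> this] show ?thesis using that by blast
        qed
        moreover have "affordable \<tau> ((b - a) / (b - 1)) \<kappa>"
          using \<tau>_fin[OF t(2)] t(1) * by (intro affordable_finite) auto
        moreover have "0 \<le> \<kappa>" using * t order.trans[of 0 "1 / s" \<kappa>] by simp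
        ultimately show ?thesis using G
          by (intro tail_bound_regular[OF ratio, of a b \<kappa>]) auto
      qed
    qed
  qed
  show ?thesis
    unfolding le_Liminf_iff
  proof (intro allI impI)
    fix y assume y: "y < - ereal (perp_const t_inf \<gamma>)"
    from ereal_dense2[OF y] obtain r where r: "y < ereal r" "ereal r < - ereal (perp_const t_inf \<gamma>)"
      by blast
    define C where "C = - r"
    have C: "y < ereal (- C)" "perp_const t_inf \<gamma> < C" using r by (simp_all add: C_def)
    have "\<forall>\<^sub>F x in at_top. 0 < f x" using f_top by (simp add: filterlim_at_top_dense)
    with bound[OF C(2)]
    show "\<forall>\<^sub>F x in at_top. y < ext_log (\<P>(\<omega> in N. R \<omega> > x)) / h x"
    proof eventually_elim
      case (elim x)
      have "ext_log (\<P>(\<omega> in N. R \<omega> > x)) / h x = ereal (ln (F x) / f x)"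
        using F_pos[of x] elim by (simp add: ext_log_def neg_log_def h_eq F_def[symmetric])
      moreover have "- C \<le> ln (F x) / f x" using elim by (simp add: field_simps)
      ultimately show ?case using C(1) by (auto intro: order_less_le_trans)
    qed
  qed
qed

end
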